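(* For integers $n, m \geq 0$, let $cp_0(n, m)$ denote the number of partitions of $n$ into $m$ parts $\lambda_1 \leq \cdots \leq \lambda_m$ such that $\lambda_{i+1} - \lambda_i \geq 2$ for all $i$, and $\lambda_{i+1} - \lambda_i \geq 4$ unless $\lambda_i + \lambda_{i+1}$ is a multiple of $3$. Then \[ \sum_{m, n \geq 0} cp_0(n,m) q^n x^m = \sum_{n_1, n_2 \geq 0} \frac{ q^{6n_2^2 + 2n_1^2 + 6n_2 n_1} (1 + xq^{6n_2 + 3n_1 + 1}) x^{2n_2 + n_1} }{ (q; q)_{n_1} (q^3; q^3)_{n_2} }. \]
   Context: A partition of $n$ into $m$ parts is a non-decreasing sequence of $m$ positive integers summing to $n$. For $n \geq 0$, $(a; q)_n = \prod_{j=1}^{n} (1 - a q^{j-1})$, with the empty product equal to $1$. *)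

theory Defs
  imports "HOL-Analysis.Analysis" "HOL-Computational_Algebra.Formal_Power_Series"
begin

definition partitions_into :: "nat \<Rightarrow> nat \<Rightarrow> nat list set" where
  "partitions_into n m =
     {xs. length xs = m \<and> sorted xs \<and> (\<forall>p\<in>set xs. 0 < p) \<and> sum_list xs = n}"

definition cp0 :: "nat \<Rightarrow> nat \<Rightarrow> nat" where
  "cp0 n m = card {xs \<in> partitions_into n m.
     \<forall>i. Suc i < m \<longrightarrow>
       xs ! Suc i - xs ! i \<ge> 2 \<and>
       (\<not> 3 dvd (xs ! i + xs ! Suc i) \<longrightarrow> xs ! Suc i - xs ! i \<ge> 4)}"

definition qpoch :: "'a::comm_ring_1 \<Rightarrow> 'a \<Rightarrow> nat \<Rightarrow> 'a" where
  "qpoch a q n = (\<Prod>j=1..n. 1 - a * q ^ (j - 1))"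

text \<open>
  The ring of formal power series in \<open>q\<close> and \<open>x\<close> is represented as \<open>\<rat>[[q]][[x]]\<close>: the outer
  variable is \<open>x\<close>, and \<open>q\<close> is the variable of the coefficient ring. Infinite sums refer to the
  library metric on the outer series, i.e. the \<open>x\<close>-adic topology with discrete coefficients. This is
  finer than the \<open>(q, x)\<close>-adic topology, so convergence here implies formal convergence in both
  variables, to the same limit.
\<close>

abbreviation q_var :: "rat fps fps" where
  "q_var \<equiv> fps_const fps_X"

abbreviation x_var :: "rat fps fps" where
  "x_var \<equiv> fps_X"

definition cp0_gf :: "rat fps fps" where
  "cp0_gf = Abs_fps (\<lambda>m. Abs_fps (\<lambda>n. of_nat (cp0 n m)))"

lemma finite_partitions_into: "finite (partitions_into n m)"
proof (rule finite_subset)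
  show "partitions_into n m \<subseteq> {xs. set xs \<subseteq> {..n} \<and> length xs = m}"
    unfolding partitions_into_def using member_le_sum_list by fastforce
  show "finite {xs. set xs \<subseteq> {..n} \<and> length xs = m}"
    by (rule finite_lists_length_eq) simp
qed

lemma qpoch_q_var:
  "qpoch (q_var ^ k) (q_var ^ k) n = fps_const (qpoch (fps_X ^ k) (fps_X ^ k) n)"
proof -
  have 1: "1 - fps_const a = fps_const (1 - a)" for a :: "rat fps"
    by (metis fps_const_1_eq_1 fps_const_sub)
  show ?thesis
    unfolding qpoch_def fps_const_power fps_const_mult 1
    by (induction n) simp_all
qed

text \<open>
  The coefficient ring is not a field, so division of series over it is meaningful only by units.
  The denominators in question are such units, i.e. the library division is the exact quotient.
\<close>

lemma denominator_divide_cancel: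
  fixes f :: "rat fps fps" and n1 n2 :: nat
  defines "d \<equiv> qpoch q_var q_var n1 * qpoch (q_var ^ 3) (q_var ^ 3) n2"
  shows "(f / d) * d = f"
proof -
  define c :: "rat fps" where
    "c = qpoch fps_X fps_X n1 * qpoch (fps_X ^ 3) (fps_X ^ 3) n2"
  have d: "d = fps_const c"
    using qpoch_q_var[of 1 n1] qpoch_q_var[of 3 n2] by (simp add: d_def c_def)
  have "fps_nth (qpoch (fps_X ^ k) (fps_X ^ k) n) 0 = (1::rat)" if "k > 0" for k n
    unfolding qpoch_def using that by (induction n) simp_all
  from this[of 1 n1] this[of 3 n2] have "fps_nth c 0 = 1" by (simp add: c_def)
  then have c: "inverse c * c = 1" and "c \<noteq> 0"
    by (auto simp: inverse_mult_eq_1)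
  have "d * inverse d = 1"
    unfolding fps_inverse_def[of d]
    by (rule fps_right_inverse) (use c in \<open>simp add: d mult.commute\<close>)
  moreover have "f / d = f * inverse d"
    using \<open>c \<noteq> 0\<close> by (simp add: fps_divide_def d)
  ultimately show ?thesis by (simp add: mult.assoc mult.commute[of _ d])
qed

end

theory Submission
  imports Defs
begin

text \<open>
  Let \<open>G(a; x)\<close> count the admissible partitions with all parts at least \<open>a\<close>. Adding \<open>3\<close> to every
  part preserves admissibility, so \<open>G(a + 3; x) = G(a; xq\<^sup>3)\<close>. Removing the smallest part gives
  \<open>G(1; x) = G(2; x) + xq G(2; xq\<^sup>3)\<close> and a linear \<open>q\<close>-difference system for \<open>G(2; x)\<close> and
  \<open>G(3; x)\<close>, which determines both from the constant term.
  With \<open>t(i, j) = q^(6j\<^sup>2 + 2i\<^sup>2 + 6ij) / ((q; q)\<^sub>i (q\<^sup>3; q\<^sup>3)\<^sub>j)\<close>, put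
  \<open>S(a, b) = \<Sum> t(i, j) q^(ai + bj) x^(i + 2j)\<close>. Cancelling one denominator factor yields
  \<open>S(a, b) - S(a + 1, b) = x q^(a + 2) S(a + 4, b + 6)\<close> and
  \<open>S(a, b) - S(a, b + 3) = x\<^sup>2 q^(b + 6) S(a + 6, b + 12)\<close>. By these relations \<open>S(0, 0)\<close> and
  \<open>S(1, 3)\<close> solve the same system, so \<open>G(2; x) = S(0, 0)\<close>.
\<close>

section \<open>Admissible partitions as lists and their generating functions\<close>

definition admissible_step :: "nat \<Rightarrow> nat \<Rightarrow> bool" where
  "admissible_step x y \<longleftrightarrow> x + 2 \<le> y \<and> (3 dvd (x + y) \<or> x + 4 \<le> y)"

text \<open>Admissible neighbours increase strictly, so a bound on the head bounds every part;
  \<open>a = 1\<close> covers positivity.\<close>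

definition admissible_from :: "nat \<Rightarrow> nat list set" where
  "admissible_from a = {xs. successively admissible_step xs \<and> (xs = [] \<or> a \<le> hd xs)}"

definition gen_fun :: "nat list set \<Rightarrow> rat fps fps" where
  "gen_fun W = Abs_fps (\<lambda>m. Abs_fps (\<lambda>n. of_nat (card {xs \<in> W. length xs = m \<and> sum_list xs = n})))"

text \<open>The substitution \<open>x \<mapsto> xq\<^sup>3\<close>.\<close>

definition dilate :: "rat fps fps \<Rightarrow> rat fps fps" where
  "dilate f = Abs_fps (\<lambda>m. fps_X ^ (3 * m) * fps_nth f m)"

lemma gen_fun_nth:
  "fps_nth (fps_nth (gen_fun W) m) n = of_nat (card {xs \<in> W. length xs = m \<and> sum_list xs = n})"
  by (simp add: gen_fun_def)

lemma dilate_nth: "fps_nth (dilate f) m = fps_X ^ (3 * m) * fps_nth f m"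
  by (simp add: dilate_def)

lemma dilate_diff: "dilate (f - g) = dilate f - dilate g"
  by (rule fps_ext) (simp add: dilate_nth algebra_simps)

text \<open>The sum bounds every entry. Without finiteness \<open>card\<close> could take its
  default value 0 and spoil the additivity in \<open>gen_fun_Un\<close>.\<close>

lemma finite_lists_length_sum: "finite {xs :: nat list. xs \<in> W \<and> length xs = m \<and> sum_list xs = n}"
proof (rule finite_subset)
  show "{xs. xs \<in> W \<and> length xs = m \<and> sum_list xs = n} \<subseteq> {xs. set xs \<subseteq> {..n} \<and> length xs = m}"
    using member_le_sum_list by fastforce
  show "finite {xs. set xs \<subseteq> {..n} \<and> length xs = m}"
    by (rule finite_lists_length_eq) simp
qed

lemma gen_fun_Un:
  assumes "A \<inter> B = {}"
  shows "gen_fun (A \<union> B) = gen_fun A + gen_fun B"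
proof (intro fps_ext)
  fix m n
  have "{xs \<in> A \<union> B. length xs = m \<and> sum_list xs = n} =
      {xs \<in> A. length xs = m \<and> sum_list xs = n} \<union> {xs \<in> B. length xs = m \<and> sum_list xs = n}"
    by auto
  moreover have "card \<dots> = card {xs \<in> A. length xs = m \<and> sum_list xs = n}
      + card {xs \<in> B. length xs = m \<and> sum_list xs = n}"
    by (rule card_Un_disjoint) (use assms finite_lists_length_sum in auto)
  ultimately show "fps_nth (fps_nth (gen_fun (A \<union> B)) m) n = fps_nth (fps_nth (gen_fun A + gen_fun B) m) n"
    by (simp add: gen_fun_nth)
qed

lemma gen_fun_Cons: "gen_fun ((#) a ` W) = x_var * q_var ^ a * gen_fun W"
proof (intro fps_ext)
  fix m n
  have rhs: "fps_nth (fps_nth (x_var * q_var ^ a * gen_fun W) m) n =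
      (if m = 0 \<or> n < a then 0 else fps_nth (fps_nth (gen_fun W) (m - 1)) (n - a))"
    by (simp add: mult.assoc fps_const_power fps_X_power_mult_nth)
  show "fps_nth (fps_nth (gen_fun ((#) a ` W)) m) n =
      fps_nth (fps_nth (x_var * q_var ^ a * gen_fun W) m) n"
  proof (cases "m = 0 \<or> n < a")
    case True
    then have "{xs \<in> (#) a ` W. length xs = m \<and> sum_list xs = n} = {}" by auto
    with True show ?thesis by (simp only: rhs gen_fun_nth) simp
  next
    case False
    then have "{xs \<in> (#) a ` W. length xs = m \<and> sum_list xs = n} =
        (#) a ` {xs \<in> W. length xs = m - 1 \<and> sum_list xs = n - a}"
      by auto
    then have "card {xs \<in> (#) a ` W. length xs = m \<and> sum_list xs = n} =
        card {xs \<in> W. length xs = m - 1 \<and> sum_list xs = n - a}"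
      by (simp add: card_image)
    with False show ?thesis by (simp only: rhs gen_fun_nth) simp
  qed
qed

lemma gen_fun_map_add_3: "gen_fun (map (\<lambda>x. x + 3) ` W) = dilate (gen_fun W)"
proof (intro fps_ext)
  fix m n
  have sum: "sum_list (map (\<lambda>x. x + 3) xs) = sum_list xs + 3 * length xs" for xs :: "nat list"
    by (induction xs) auto
  show "fps_nth (fps_nth (gen_fun (map (\<lambda>x. x + 3) ` W)) m) n = fps_nth (fps_nth (dilate (gen_fun W)) m) n"
  proof (cases "n < 3 * m")
    case True
    then have "{xs \<in> map (\<lambda>x. x + 3) ` W. length xs = m \<and> sum_list xs = n} = {}"
      by (auto simp: sum)
    with True show ?thesis
      by (simp only: dilate_nth fps_X_power_mult_nth gen_fun_nth) simp
  next
    case False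
    then have "{xs \<in> map (\<lambda>x. x + 3) ` W. length xs = m \<and> sum_list xs = n} =
        map (\<lambda>x. x + 3) ` {xs \<in> W. length xs = m \<and> sum_list xs = n - 3 * m}"
      by (auto simp: sum)
    moreover have "inj_on (map (\<lambda>x::nat. x + 3)) Y" for Y by (simp add: inj_on_def)
    ultimately have "card {xs \<in> map (\<lambda>x. x + 3) ` W. length xs = m \<and> sum_list xs = n} =
        card {xs \<in> W. length xs = m \<and> sum_list xs = n - 3 * m}"
      by (simp add: card_image)
    with False show ?thesis
      by (simp only: dilate_nth fps_X_power_mult_nth gen_fun_nth) simp
  qed
qed

section \<open>Shifting all parts by 3 and removing the smallest part\<close>

text \<open>The shift keeps the gap and adds 6 to the sum of the neighbours, so divisibility by 3 is
  preserved; a shift by 1 or 2 would destroy it.\<close>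

lemma admissible_step_add_3: "admissible_step (x + 3) (y + 3) \<longleftrightarrow> admissible_step x y"
proof -
  have "x + 3 + (y + 3) = x + y + 3 * 2" by simp
  then have "3 dvd (x + 3 + (y + 3)) \<longleftrightarrow> 3 dvd (x + y)" by presburger
  then show ?thesis unfolding admissible_step_def by auto
qed

lemma admissible_from_add_3: "admissible_from (a + 3) = map (\<lambda>x. x + 3) ` admissible_from a"
proof
  have "map (\<lambda>x. x + 3) xs \<in> admissible_from (a + 3)" if "xs \<in> admissible_from a" for xs
    using that unfolding admissible_from_def
    by (cases "xs = []") (simp_all add: hd_map successively_map admissible_step_add_3)
  then show "map (\<lambda>x. x + 3) ` admissible_from a \<subseteq> admissible_from (a + 3)" by blast
  have "\<exists>ys \<in> admissible_from a. xs = map (\<lambda>x. x + 3) ys" if "xs \<in> admissible_from (a + 3)" for xs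
    using that
  \<comment> \<open>The bound varies because the tail is treated with the bound \<open>z\<close>,
    the head lowered by 3.\<close>
  proof (induction xs arbitrary: a)
    case Nil
    then show ?case by (simp add: admissible_from_def)
  next
    case (Cons x xs)
    define z where "z = x - 3"
    with Cons.prems have x: "x = z + 3" "a \<le> z" by (auto simp: admissible_from_def)
    with Cons.prems have "xs \<in> admissible_from (z + 3)"
      by (auto simp: admissible_from_def successively_Cons admissible_step_def)
    from Cons.IH[OF this] obtain ys where ys: "ys \<in> admissible_from z" "xs = map (\<lambda>x. x + 3) ys"
      by blast
    have "z # ys \<in> admissible_from a"
      using Cons.prems ys x
      by (cases "ys = []")
        (simp_all add: admissible_from_def successively_Cons hd_map admissible_step_add_3)
    with x ys show ?case by (intro bexI[of _ "z # ys"]) auto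
  qed
  then show "admissible_from (a + 3) \<subseteq> map (\<lambda>x. x + 3) ` admissible_from a" by blast
qed

lemma gen_fun_admissible_from_add_3:
  "gen_fun (admissible_from (a + 3)) = dilate (gen_fun (admissible_from a))"
  by (simp only: admissible_from_add_3 gen_fun_map_add_3)

text \<open>A list either avoids the part \<open>a\<close> or starts with it. Which heads may follow
  \<open>a\<close> depends only on the residue of \<open>a\<close> modulo 3.\<close>

lemma gen_fun_admissible_from_rec:
  "gen_fun (admissible_from a) = gen_fun (admissible_from (a + 1)) + x_var * q_var ^ a *
     gen_fun {xs. successively admissible_step xs \<and> (xs = [] \<or> admissible_step a (hd xs))}"
    (is "_ = _ + _ * gen_fun ?N")
proof -
  have eq: "admissible_from a = admissible_from (a + 1) \<union> (#) a ` ?N"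
  proof (intro set_eqI)
    show "xs \<in> admissible_from a \<longleftrightarrow> xs \<in> admissible_from (a + 1) \<union> (#) a ` ?N" for xs
      by (cases xs) (auto simp: admissible_from_def successively_Cons image_iff le_eq_less_or_eq)
  qed
  have "admissible_from (a + 1) \<inter> (#) a ` ?N = {}"
    by (auto simp: admissible_from_def)
  then show ?thesis unfolding eq gen_fun_Cons[symmetric] by (rule gen_fun_Un)
qed

text \<open>Gaps 2 and 3 after \<open>a\<close> give the sums \<open>2a + 2\<close> and
  \<open>2a + 3\<close>. For \<open>a\<close> divisible by 3 only the second is a multiple of 3; for
  residue 1 neither is; for residue 2 only the first.\<close>

lemma gen_fun_from_0_mod_3:
  assumes "a mod 3 = 0"
  shows "gen_fun (admissible_from a) =
    gen_fun (admissible_from (a + 1)) + x_var * q_var ^ a * gen_fun (admissible_from (a + 3))"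
proof -
  have "admissible_step a y \<longleftrightarrow> a + 3 \<le> y" for y
    using assms unfolding admissible_step_def by presburger
  then show ?thesis
    using gen_fun_admissible_from_rec[of a] by (simp add: admissible_from_def)
qed

lemma gen_fun_from_1_mod_3:
  assumes "a mod 3 = 1"
  shows "gen_fun (admissible_from a) =
    gen_fun (admissible_from (a + 1)) + x_var * q_var ^ a * gen_fun (admissible_from (a + 4))"
proof -
  have "admissible_step a y \<longleftrightarrow> a + 4 \<le> y" for y
    using assms unfolding admissible_step_def by presburger
  then show ?thesis
    using gen_fun_admissible_from_rec[of a] by (simp add: admissible_from_def)
qed

text \<open>The successors \<open>a + 2\<close> and \<open>y >= a + 4\<close> leave a hole at
  \<open>a + 3\<close>; the difference of two generating functions isolates the tails with head
  \<open>a + 2\<close>.\<close>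

lemma gen_fun_from_2_mod_3:
  assumes "a mod 3 = 2"
  shows "gen_fun (admissible_from a) = gen_fun (admissible_from (a + 1)) + x_var * q_var ^ a *
    (gen_fun (admissible_from (a + 2)) - gen_fun (admissible_from (a + 3)) + gen_fun (admissible_from (a + 4)))"
proof -
  define N where "N = {xs. successively admissible_step xs \<and> (xs = [] \<or> admissible_step a (hd xs))}"
  define M where "M = {xs. successively admissible_step xs \<and> xs \<noteq> [] \<and> hd xs = a + 2}"
  have step: "admissible_step a y \<longleftrightarrow> y = a + 2 \<or> a + 4 \<le> y" for y
    using assms unfolding admissible_step_def by presburger
  have "N = M \<union> admissible_from (a + 4)" "M \<inter> admissible_from (a + 4) = {}"
    by (auto simp: N_def M_def admissible_from_def step)
  then have "gen_fun N = gen_fun M + gen_fun (admissible_from (a + 4))"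
    using gen_fun_Un by metis
  moreover have "admissible_from (a + 2) = M \<union> admissible_from (a + 3)" "M \<inter> admissible_from (a + 3) = {}"
    by (auto simp: M_def admissible_from_def)
  then have "gen_fun (admissible_from (a + 2)) = gen_fun M + gen_fun (admissible_from (a + 3))"
    using gen_fun_Un by metis
  ultimately show ?thesis
    using gen_fun_admissible_from_rec[of a, folded N_def] by simp
qed

lemma cp0_gf_eq: "cp0_gf = gen_fun (admissible_from 1)"
proof -
  have sorted: "sorted xs" if "successively admissible_step xs" for xs
  proof -
    have "successively (\<le>) xs"
      using that by (rule successively_mono) (simp add: admissible_step_def)
    then show ?thesis by (simp add: successively_conv_sorted_wrt)
  qed
  have pos: "(\<forall>p\<in>set xs. 0 < p) \<longleftrightarrow> xs = [] \<or> 1 \<le> hd xs" if "sorted xs" for xs :: "nat list"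
    using that by (cases xs) auto
  \<comment> \<open>Truncated subtraction is harmless: a difference of at least 2 already forces
    \<open>x + 2 <= y\<close>.\<close>
  have diff: "2 \<le> y - x \<and> (\<not> 3 dvd (x + y) \<longrightarrow> 4 \<le> y - x) \<longleftrightarrow> admissible_step x y" for x y :: nat
    by (auto simp: admissible_step_def)
  have "{xs \<in> partitions_into n m. \<forall>i. Suc i < m \<longrightarrow>
       xs ! Suc i - xs ! i \<ge> 2 \<and>
       (\<not> 3 dvd (xs ! i + xs ! Suc i) \<longrightarrow> xs ! Suc i - xs ! i \<ge> 4)} =
     {xs \<in> admissible_from 1. length xs = m \<and> sum_list xs = n}" for n m
    unfolding diff partitions_into_def admissible_from_def
    using sorted pos by (auto simp: successively_conv_nth)
  then show ?thesis by (simp add: cp0_gf_def cp0_def gen_fun_def)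
qed

section \<open>The double series and its contiguity relations\<close>

definition summand :: "nat \<Rightarrow> nat \<Rightarrow> rat fps" where
  "summand i j = fps_X ^ (6 * j\<^sup>2 + 2 * i\<^sup>2 + 6 * j * i)
     * inverse (qpoch fps_X fps_X i) * inverse (qpoch (fps_X ^ 3) (fps_X ^ 3) j)"

definition index_pairs :: "nat \<Rightarrow> (nat \<times> nat) set" where
  "index_pairs m = {(i, j). i + 2 * j = m}"

text \<open>This is \<open>S(a, b)\<close>. Grouping by the exponent \<open>i + 2j\<close> of
  \<open>x\<close> makes every coefficient a finite sum, so convergence enters only in the final
  theorem.\<close>

definition weighted_series :: "nat \<Rightarrow> nat \<Rightarrow> rat fps fps" where
  "weighted_series a b =
     Abs_fps (\<lambda>m. \<Sum>(i, j)\<in>index_pairs m. summand i j * fps_X ^ (a * i + b * j))"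

lemma weighted_series_nth:
  "fps_nth (weighted_series a b) m = (\<Sum>(i, j)\<in>index_pairs m. summand i j * fps_X ^ (a * i + b * j))"
  by (simp add: weighted_series_def)

lemma fps_X_power_mult_weighted_series_nth:
  "fps_X ^ k * fps_nth (weighted_series a b) m =
     (\<Sum>(i, j)\<in>index_pairs m. fps_X ^ k * (summand i j * fps_X ^ (a * i + b * j)))"
  by (simp add: weighted_series_nth sum_distrib_left case_prod_unfold)

lemma sum_prod_eqI:
  assumes "\<And>i j. (i, j) \<in> A \<Longrightarrow> f (i, j) = g i j"
  shows "sum f A = (\<Sum>(i, j)\<in>A. g i j)"
  using assms by (intro sum.cong) auto

lemma finite_index_pairs: "finite (index_pairs m)"
  by (rule finite_subset[of _ "{..m} \<times> {..m}"]) (auto simp: index_pairs_def)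

lemma qpoch_Suc: "qpoch a q (Suc n) = qpoch a q n * (1 - a * q ^ n)"
  by (simp add: qpoch_def)

lemma qpoch_fps_X_nth_0: "k > 0 \<Longrightarrow> fps_nth (qpoch (fps_X ^ k) (fps_X ^ k) n) 0 = (1::rat)"
  by (induction n) (simp_all add: qpoch_def)

lemma inverse_qpoch_Suc:
  assumes "k > 0"
  shows "inverse (qpoch (fps_X ^ k) (fps_X ^ k) (Suc n)) * (1 - fps_X ^ (k * Suc n)) =
     inverse (qpoch (fps_X ^ k) (fps_X ^ k) n :: rat fps)"
proof -
  have "fps_nth (1 - fps_X ^ (k * Suc n) :: rat fps) 0 \<noteq> 0" using assms by simp
  then have "inverse (1 - fps_X ^ (k * Suc n) :: rat fps) * (1 - fps_X ^ (k * Suc n)) = 1"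
    by (rule inverse_mult_eq_1)
  moreover have "qpoch (fps_X ^ k) (fps_X ^ k) (Suc n) =
      qpoch (fps_X ^ k) (fps_X ^ k) n * (1 - fps_X ^ (k * Suc n) :: rat fps)"
    by (simp add: qpoch_Suc power_add power_mult)
  ultimately show ?thesis by (simp add: fps_inverse_mult mult.assoc)
qed

text \<open>Passing to \<open>i + 1\<close> raises the quadratic exponent by
  \<open>4i + 6j + 2\<close>. As this is linear in \<open>i\<close> and \<open>j\<close>, it can be
  absorbed into the weights \<open>a\<close> and \<open>b\<close>.\<close>

lemma summand_Suc_left:
  "summand (Suc i) j * (1 - fps_X ^ Suc i) = summand i j * fps_X ^ (4 * i + 6 * j + 2)"
proof -
  have inv: "inverse (qpoch fps_X fps_X (Suc i)) * (1 - fps_X ^ Suc i) = inverse (qpoch fps_X fps_X i :: rat fps)"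
    using inverse_qpoch_Suc[of 1 i] by simp
  have "6 * j\<^sup>2 + 2 * (Suc i)\<^sup>2 + 6 * j * Suc i = (6 * j\<^sup>2 + 2 * i\<^sup>2 + 6 * j * i) + (4 * i + 6 * j + 2)"
    by (simp add: power2_eq_square algebra_simps)
  then show ?thesis
    unfolding summand_def inv[symmetric] by (simp only: power_add mult_ac)
qed

lemma summand_Suc_right:
  "summand i (Suc j) * (1 - fps_X ^ (3 * Suc j)) = summand i j * fps_X ^ (6 * i + 12 * j + 6)"
proof -
  have inv: "inverse (qpoch (fps_X ^ 3) (fps_X ^ 3) (Suc j)) * (1 - fps_X ^ (3 * Suc j)) =
      inverse (qpoch (fps_X ^ 3) (fps_X ^ 3) j :: rat fps)"
    using inverse_qpoch_Suc[of 3 j] by simp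
  have "6 * (Suc j)\<^sup>2 + 2 * i\<^sup>2 + 6 * Suc j * i = (6 * j\<^sup>2 + 2 * i\<^sup>2 + 6 * j * i) + (6 * i + 12 * j + 6)"
    by (simp add: power2_eq_square algebra_simps)
  then show ?thesis
    unfolding summand_def inv[symmetric] by (simp only: power_add mult_ac)
qed

text \<open>Subtracting puts \<open>1 - q^i\<close> into each term. This kills \<open>i = 0\<close>
  and otherwise cancels the last factor of \<open>(q; q)_i\<close>; lowering \<open>i\<close> by one
  then changes the weights to \<open>(a + 4, b + 6)\<close>.\<close>

lemma weighted_series_left:
  "weighted_series a b =
     weighted_series (a + 1) b + x_var * q_var ^ (a + 2) * weighted_series (a + 4) (b + 6)"
proof (rule fps_ext)
  fix m
  let ?g = "\<lambda>(i, j). summand i j * (1 - fps_X ^ i) * fps_X ^ (a * i + b * j)"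
  have diff: "fps_nth (weighted_series a b) m - fps_nth (weighted_series (a + 1) b) m = sum ?g (index_pairs m)"
    unfolding weighted_series_nth sum_subtractf[symmetric]
    by (intro sum.cong) (auto simp: algebra_simps power_add)
  have "sum ?g (index_pairs m) = fps_nth (x_var * q_var ^ (a + 2) * weighted_series (a + 4) (b + 6)) m"
  proof (cases m)
    case 0
    then have "index_pairs m = {(0, 0)}" by (auto simp: index_pairs_def)
    with 0 show ?thesis by (simp add: mult.assoc)
  next
    case (Suc k)
    have "sum ?g (index_pairs m) = sum ?g (map_prod Suc id ` index_pairs k)"
    proof (rule sum.mono_neutral_right)
      show "\<forall>p \<in> index_pairs m - map_prod Suc id ` index_pairs k. ?g p = 0"
      proof
        fix p assume "p \<in> index_pairs m - map_prod Suc id ` index_pairs k"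
        then obtain i j where p: "p = (i, j)"
          and ij: "(i, j) \<in> index_pairs m" "(i, j) \<notin> map_prod Suc id ` index_pairs k"
          by (cases p) auto
        have "i = 0"
        proof (rule ccontr)
          assume "i \<noteq> 0"
          then have "(i, j) = map_prod Suc id (i - 1, j)" "(i - 1, j) \<in> index_pairs k"
            using ij(1) Suc by (auto simp: index_pairs_def)
          with ij(2) show False by blast
        qed
        then show "?g p = 0" by (simp add: p)
      qed
    qed (simp add: finite_index_pairs, auto simp: index_pairs_def Suc)
    also have "\<dots> = sum (?g \<circ> map_prod Suc id) (index_pairs k)"
      by (rule sum.reindex) (auto simp: inj_on_def)
    also have "\<dots> = fps_X ^ (a + 2) * fps_nth (weighted_series (a + 4) (b + 6)) k"
      unfolding fps_X_power_mult_weighted_series_nth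
    proof (rule sum_prod_eqI)
      fix i j
      have "(?g \<circ> map_prod Suc id) (i, j) =
          summand (Suc i) j * (1 - fps_X ^ Suc i) * fps_X ^ (a * Suc i + b * j)" by simp
      also have "\<dots> = summand i j * (fps_X ^ (4 * i + 6 * j + 2) * fps_X ^ (a * Suc i + b * j))"
        by (simp only: summand_Suc_left mult.assoc)
      also have "fps_X ^ (4 * i + 6 * j + 2) * fps_X ^ (a * Suc i + b * j) =
          fps_X ^ (a + 2) * (fps_X ^ ((a + 4) * i + (b + 6) * j) :: rat fps)"
        unfolding power_add[symmetric] by (rule arg_cong[where f = "power _"]) (simp add: algebra_simps)
      finally show "(?g \<circ> map_prod Suc id) (i, j) =
          fps_X ^ (a + 2) * (summand i j * fps_X ^ ((a + 4) * i + (b + 6) * j))"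
        by (simp add: mult_ac)
    qed
    finally show ?thesis
      using Suc by (simp add: mult.assoc fps_const_power del: power_Suc)
  qed
  with diff show "fps_nth (weighted_series a b) m = fps_nth
     (weighted_series (a + 1) b + x_var * q_var ^ (a + 2) * weighted_series (a + 4) (b + 6)) m"
    by (simp add: algebra_simps)
qed

text \<open>The same argument with \<open>1 - q^(3j)\<close> and \<open>(q^3; q^3)_j\<close>. A unit
  of \<open>j\<close> counts twice in the exponent of \<open>x\<close>, hence \<open>x^2\<close> and
  the separate case \<open>m < 2\<close>.\<close>

lemma weighted_series_right:
  "weighted_series a b =
     weighted_series a (b + 3) + x_var ^ 2 * q_var ^ (b + 6) * weighted_series (a + 6) (b + 12)"
proof (rule fps_ext)
  fix m
  let ?g = "\<lambda>(i, j). summand i j * (1 - fps_X ^ (3 * j)) * fps_X ^ (a * i + b * j)"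
  have diff: "fps_nth (weighted_series a b) m - fps_nth (weighted_series a (b + 3)) m = sum ?g (index_pairs m)"
    unfolding weighted_series_nth sum_subtractf[symmetric]
    by (intro sum.cong) (auto simp: algebra_simps power_add)
  have "sum ?g (index_pairs m) = fps_nth (x_var ^ 2 * q_var ^ (b + 6) * weighted_series (a + 6) (b + 12)) m"
  proof (cases "m < 2")
    case True
    then have "snd p = 0" if "p \<in> index_pairs m" for p using that by (auto simp: index_pairs_def)
    then have "sum ?g (index_pairs m) = 0" by (intro sum.neutral) (simp add: case_prod_unfold)
    with True show ?thesis by (simp add: mult.assoc fps_X_power_mult_nth)
  next
    case False
    define k where "k = m - 2"
    with False have m: "m = k + 2" by simp
    have "sum ?g (index_pairs m) = sum ?g (map_prod id Suc ` index_pairs k)"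
    proof (rule sum.mono_neutral_right)
      show "\<forall>p \<in> index_pairs m - map_prod id Suc ` index_pairs k. ?g p = 0"
      proof
        fix p assume "p \<in> index_pairs m - map_prod id Suc ` index_pairs k"
        then obtain i j where p: "p = (i, j)"
          and ij: "(i, j) \<in> index_pairs m" "(i, j) \<notin> map_prod id Suc ` index_pairs k"
          by (cases p) auto
        have "j = 0"
        proof (rule ccontr)
          assume "j \<noteq> 0"
          then have "(i, j) = map_prod id Suc (i, j - 1)" "(i, j - 1) \<in> index_pairs k"
            using ij(1) m by (auto simp: index_pairs_def)
          with ij(2) show False by blast
        qed
        then show "?g p = 0" by (simp add: p)
      qed
    qed (simp add: finite_index_pairs, auto simp: index_pairs_def m)
    also have "\<dots> = sum (?g \<circ> map_prod id Suc) (index_pairs k)"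
      by (rule sum.reindex) (auto simp: inj_on_def)
    also have "\<dots> = fps_X ^ (b + 6) * fps_nth (weighted_series (a + 6) (b + 12)) k"
      unfolding fps_X_power_mult_weighted_series_nth
    proof (rule sum_prod_eqI)
      fix i j
      have "(?g \<circ> map_prod id Suc) (i, j) =
          summand i (Suc j) * (1 - fps_X ^ (3 * Suc j)) * fps_X ^ (a * i + b * Suc j)" by simp
      also have "\<dots> = summand i j * (fps_X ^ (6 * i + 12 * j + 6) * fps_X ^ (a * i + b * Suc j))"
        by (simp only: summand_Suc_right mult.assoc)
      also have "fps_X ^ (6 * i + 12 * j + 6) * fps_X ^ (a * i + b * Suc j) =
          fps_X ^ (b + 6) * (fps_X ^ ((a + 6) * i + (b + 12) * j) :: rat fps)"
        unfolding power_add[symmetric] by (rule arg_cong[where f = "power _"]) (simp add: algebra_simps)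
      finally show "(?g \<circ> map_prod id Suc) (i, j) =
          fps_X ^ (b + 6) * (summand i j * fps_X ^ ((a + 6) * i + (b + 12) * j))"
        by (simp add: mult_ac)
    qed
    finally show ?thesis
      using m by (simp add: mult.assoc fps_const_power fps_X_power_mult_nth del: power_Suc)
  qed
  with diff show "fps_nth (weighted_series a b) m = fps_nth
     (weighted_series a (b + 3) + x_var ^ 2 * q_var ^ (b + 6) * weighted_series (a + 6) (b + 12)) m"
    by (simp add: algebra_simps)
qed

text \<open>On the pairs contributing to \<open>x^m\<close> one has \<open>3m = 3i + 6j\<close>, so
  the weights absorb the substitution.\<close>

lemma dilate_weighted_series: "dilate (weighted_series a b) = weighted_series (a + 3) (b + 6)"
proof (rule fps_ext)
  fix m
  show "fps_nth (dilate (weighted_series a b)) m = fps_nth (weighted_series (a + 3) (b + 6)) m"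
    unfolding dilate_nth fps_X_power_mult_weighted_series_nth
    unfolding weighted_series_nth
  proof (rule sum.cong[OF refl], clarify)
    fix i j assume "(i, j) \<in> index_pairs m"
    then have "(a + 3) * i + (b + 6) * j = 3 * m + (a * i + b * j)"
      by (auto simp: index_pairs_def algebra_simps)
    then show "fps_X ^ (3 * m) * (summand i j * fps_X ^ (a * i + b * j)) =
        summand i j * fps_X ^ ((a + 3) * i + (b + 6) * j)"
      by (simp only: power_add mult_ac)
  qed
qed

section \<open>A q-difference system with a unique solution\<close>

text \<open>For \<open>A = G(2)\<close> and \<open>H = G(3)\<close>, the terms
  \<open>dilate A\<close>, \<open>dilate (dilate A)\<close> and \<open>dilate H\<close> are
  \<open>G(5)\<close>, \<open>G(8)\<close> and \<open>G(6)\<close>. The equations arise by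
  eliminating \<open>G(4)\<close> from the recurrences at 2, 3 and 4.\<close>

definition q_difference_system :: "rat fps fps \<Rightarrow> rat fps fps \<Rightarrow> bool" where
  "q_difference_system A H \<longleftrightarrow>
     H = dilate A + x_var * q_var ^ 4 * dilate (dilate A) + x_var * q_var ^ 3 * dilate H \<and>
     A = H + x_var ^ 2 * q_var ^ 6 * dilate (dilate A) + x_var * q_var ^ 2 * dilate H"

text \<open>By linearity the differences \<open>D\<close> and \<open>E\<close> solve the system too.
  Terms with a factor \<open>x\<close> involve lower coefficients only, so inductively
  \<open>E_m = q^(3m) D_m\<close> and \<open>D_m = E_m\<close> remain.\<close>

lemma q_difference_system_unique:
  assumes "q_difference_system A H" "q_difference_system A' H'"
    and "fps_nth A 0 = fps_nth A' 0"
  shows "A = A'"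
proof -
  define D where "D = A - A'"
  define E where "E = H - H'"
  have E: "E = dilate D + x_var * q_var ^ 4 * dilate (dilate D) + x_var * q_var ^ 3 * dilate E"
    using assms(1,2) unfolding q_difference_system_def D_def E_def dilate_diff
    by (simp add: algebra_simps)
  have D: "D = E + x_var ^ 2 * q_var ^ 6 * dilate (dilate D) + x_var * q_var ^ 2 * dilate E"
    using assms(1,2) unfolding q_difference_system_def D_def E_def dilate_diff
    by (simp add: algebra_simps)
  have "fps_nth D m = 0 \<and> fps_nth E m = 0" for m
  proof (induction m rule: less_induct)
    case (less m)
    have Em: "fps_nth E m = fps_X ^ (3 * m) * fps_nth D m"
      by (subst E) (use less in \<open>simp add: mult.assoc fps_const_power dilate_nth\<close>)
    have Dm: "fps_nth D m = fps_nth E m"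
      by (subst D) (use less in \<open>simp add: mult.assoc fps_const_power dilate_nth fps_X_power_mult_nth\<close>)
    show ?case
    \<comment> \<open>At \<open>m = 0\<close> the factor \<open>1 - q^(3m)\<close> is zero, and the
      assumption on the constant terms takes over.\<close>
    proof (cases "m = 0")
      case True
      then show ?thesis using assms(3) Dm by (simp add: D_def)
    next
      case False
      have "(1 - fps_X ^ (3 * m)) * fps_nth D m = 0"
        using Em Dm by (simp add: algebra_simps)
      moreover have "fps_nth (1 - fps_X ^ (3 * m) :: rat fps) 0 \<noteq> 0" using False by simp
      then have "1 - fps_X ^ (3 * m) \<noteq> (0 :: rat fps)" by force
      ultimately show ?thesis using Dm by simp
    qed
  qed
  then have "D = 0" by (intro fps_ext) simp
  then show ?thesis by (simp add: D_def)
qed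

lemma q_difference_system_gen_fun:
  "q_difference_system (gen_fun (admissible_from 2)) (gen_fun (admissible_from 3))"
proof -
  let ?G = "\<lambda>a. gen_fun (admissible_from a)"
  have shift: "dilate (?G 2) = ?G 5" "dilate (?G 5) = ?G 8" "dilate (?G 3) = ?G 6"
    using gen_fun_admissible_from_add_3[of 2] gen_fun_admissible_from_add_3[of 5]
      gen_fun_admissible_from_add_3[of 3] by simp_all
  have G2: "?G 2 = ?G 3 + x_var * q_var ^ 2 * (?G 4 - ?G 5 + ?G 6)"
    using gen_fun_from_2_mod_3[of 2] by simp
  have G3: "?G 3 = ?G 4 + x_var * q_var ^ 3 * ?G 6"
    using gen_fun_from_0_mod_3[of 3] by simp
  have G4: "?G 4 = ?G 5 + x_var * q_var ^ 4 * ?G 8"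
    using gen_fun_from_1_mod_3[of 4] by simp
  \<comment> \<open>Read \<open>u\<close>, \<open>v\<close>, \<open>w\<close> as
    \<open>G(5)\<close>, \<open>G(8)\<close>, \<open>G(6)\<close>: inserting the recurrence for
    \<open>G(4)\<close> makes \<open>G(5)\<close> cancel.\<close>
  have "x * q ^ 2 * (u + x * q ^ 4 * v - u + w) = x ^ 2 * q ^ 6 * v + x * q ^ 2 * w"
    for x q u v w :: "rat fps fps"
    by (simp add: algebra_simps eval_nat_numeral)
  then show ?thesis
    unfolding q_difference_system_def shift unfolding G2 G3 G4 by (simp only: add.assoc)
qed

lemma q_difference_system_weighted_series:
  "q_difference_system (weighted_series 0 0) (weighted_series 1 3)"
proof -
  let ?S = weighted_series
  have shift: "dilate (?S 0 0) = ?S 3 6" "dilate (?S 3 6) = ?S 6 12" "dilate (?S 1 3) = ?S 4 9"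
    by (simp_all add: dilate_weighted_series)
  \<comment> \<open>The path from \<open>(1, 3)\<close> through \<open>(2, 3)\<close> and
    \<open>(3, 3)\<close> to \<open>(3, 6)\<close> leaves correction terms. They match once
    \<open>(6, 9)\<close> is expanded as well and, on the other side, \<open>(4, 9)\<close> and
    \<open>(8, 15)\<close>.\<close>
  have left: "?S 1 3 = ?S 2 3 + x_var * q_var ^ 3 * ?S 5 9"
    "?S 2 3 = ?S 3 3 + x_var * q_var ^ 4 * ?S 6 9"
    "?S 4 9 = ?S 5 9 + x_var * q_var ^ 6 * ?S 8 15"
    "?S 8 15 = ?S 9 15 + x_var * q_var ^ 10 * ?S 12 21"
    using weighted_series_left[of 1 3] weighted_series_left[of 2 3] weighted_series_left[of 4 9]
      weighted_series_left[of 8 15] by (simp_all add: numeral_eq_Suc)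
  have right: "?S 3 3 = ?S 3 6 + x_var ^ 2 * q_var ^ 9 * ?S 9 15"
    "?S 6 9 = ?S 6 12 + x_var ^ 2 * q_var ^ 15 * ?S 12 21"
    using weighted_series_right[of 3 3] weighted_series_right[of 6 9] by simp_all
  have "?S 1 3 = ?S 3 6 + x_var * q_var ^ 4 * ?S 6 12 + x_var * q_var ^ 3 * ?S 4 9"
    unfolding left right by algebra
  moreover have "?S 0 0 = ?S 1 3 + x_var ^ 2 * q_var ^ 6 * ?S 6 12 + x_var * q_var ^ 2 * ?S 4 9"
  proof -
    \<comment> \<open>Now the path is \<open>(0, 0)\<close>, \<open>(1, 0)\<close>,
      \<open>(1, 3)\<close>. Expanding \<open>(4, 6)\<close> and, on the other side,
      \<open>(6, 12)\<close> leaves only \<open>(1, 3)\<close>, \<open>(4, 9)\<close>,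
      \<open>(7, 12)\<close> and \<open>(10, 18)\<close>.\<close>
    have left: "?S 0 0 = ?S 1 0 + x_var * q_var ^ 2 * ?S 4 6"
      "?S 6 12 = ?S 7 12 + x_var * q_var ^ 8 * ?S 10 18"
      using weighted_series_left[of 0 0] weighted_series_left[of 6 12]
      by (simp_all add: numeral_eq_Suc)
    have right: "?S 1 0 = ?S 1 3 + x_var ^ 2 * q_var ^ 6 * ?S 7 12"
      "?S 4 6 = ?S 4 9 + x_var ^ 2 * q_var ^ 12 * ?S 10 18"
      using weighted_series_right[of 1 0] weighted_series_right[of 4 6] by simp_all
    show ?thesis unfolding left right by algebra
  qed
  ultimately show ?thesis
    unfolding q_difference_system_def shift by blast
qed

lemma cp0_gf_eq_weighted_series:
  "cp0_gf = weighted_series 0 0 + x_var * q_var * weighted_series 3 6"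
proof -
  have "fps_nth (gen_fun (admissible_from 2)) 0 = 1"
  proof (rule fps_ext)
    fix n
    have "{xs \<in> admissible_from 2. length xs = 0 \<and> sum_list xs = n} = (if n = 0 then {[]} else {})"
      by (auto simp: admissible_from_def)
    then show "fps_nth (fps_nth (gen_fun (admissible_from 2)) 0) n = fps_nth 1 n"
      by (simp add: gen_fun_nth)
  qed
  moreover have "index_pairs 0 = {(0, 0)}" by (auto simp: index_pairs_def)
  then have "fps_nth (weighted_series 0 0) 0 = 1"
    by (simp add: weighted_series_nth summand_def qpoch_def)
  ultimately have "gen_fun (admissible_from 2) = weighted_series 0 0"
    using q_difference_system_unique q_difference_system_gen_fun q_difference_system_weighted_series
    by metis
  moreover have "gen_fun (admissible_from 1) = gen_fun (admissible_from 2)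
      + x_var * q_var * dilate (gen_fun (admissible_from 2))"
    using gen_fun_from_1_mod_3[of 1] gen_fun_admissible_from_add_3[of 2] by (simp add: numeral_2_eq_2)
  ultimately show ?thesis by (simp add: cp0_gf_eq dilate_weighted_series)
qed

section \<open>Summation in the x-adic topology\<close>

text \<open>It suffices that each coefficient of the finite partial sums is eventually constant,
  which holds as soon as the index set contains \<open>I m\<close>.\<close>

lemma has_sum_fpsI:
  fixes f :: "'i \<Rightarrow> 'a :: ab_group_add fps"
  assumes "\<And>m. finite (I m)" "\<And>m. I m \<subseteq> A"
    and "\<And>m i. i \<in> A - I m \<Longrightarrow> fps_nth (f i) m = 0"
    and "\<And>m. fps_nth F m = (\<Sum>i\<in>I m. fps_nth (f i) m)"
  shows "(f has_sum F) A"
  unfolding has_sum_def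
proof (rule tendsto_fpsI)
  fix m
  have "fps_nth (sum f X) m = fps_nth F m" if "finite X" "I m \<subseteq> X" "X \<subseteq> A" for X
    unfolding fps_sum_nth assms(4) by (rule sum.mono_neutral_right) (use that assms(3) in auto)
  then show "\<forall>\<^sub>F X in finite_subsets_at_top A. fps_nth (sum f X) m = fps_nth F m"
    unfolding eventually_finite_subsets_at_top using assms(1,2) by metis
qed

text \<open>Expanding \<open>1 + x q^(6j + 3i + 1)\<close> splits each term into two monomials in
  \<open>x\<close>, whose coefficients can be read off.\<close>

lemma double_sum_term_eq:
  fixes i j :: nat
  shows "q_var ^ (6 * j\<^sup>2 + 2 * i\<^sup>2 + 6 * j * i) * (1 + x_var * q_var ^ (6 * j + 3 * i + 1))
      * x_var ^ (2 * j + i) / (qpoch q_var q_var i * qpoch (q_var ^ 3) (q_var ^ 3) j)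
    = fps_const (summand i j) * x_var ^ (i + 2 * j)
      + fps_const (summand i j * fps_X ^ (3 * i + 6 * j + 1)) * x_var ^ Suc (i + 2 * j)"
    (is "?n / ?d = ?r")
proof -
  define c :: "rat fps" where "c = qpoch fps_X fps_X i * qpoch (fps_X ^ 3) (fps_X ^ 3) j"
  have d: "?d = fps_const c"
    using qpoch_q_var[of 1 i] qpoch_q_var[of 3 j] by (simp add: c_def)
  have "fps_nth (qpoch fps_X fps_X i :: rat fps) 0 = 1"
    "fps_nth (qpoch (fps_X ^ 3) (fps_X ^ 3) j :: rat fps) 0 = 1"
    using qpoch_fps_X_nth_0[of 1 i] qpoch_fps_X_nth_0[of 3 j] by simp_all
  then have c0: "fps_nth c 0 = 1"
    and "inverse (qpoch fps_X fps_X i) * qpoch fps_X fps_X i = (1 :: rat fps)"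
    and "inverse (qpoch (fps_X ^ 3) (fps_X ^ 3) j) * qpoch (fps_X ^ 3) (fps_X ^ 3) j = (1 :: rat fps)"
    by (simp_all add: c_def inverse_mult_eq_1)
  moreover have "summand i j * c = fps_X ^ (6 * j\<^sup>2 + 2 * i\<^sup>2 + 6 * j * i)
      * (inverse (qpoch fps_X fps_X i) * qpoch fps_X fps_X i)
      * (inverse (qpoch (fps_X ^ 3) (fps_X ^ 3) j) * qpoch (fps_X ^ 3) (fps_X ^ 3) j)"
    unfolding summand_def c_def by (simp only: mult_ac)
  ultimately have "summand i j * c = fps_X ^ (6 * j\<^sup>2 + 2 * i\<^sup>2 + 6 * j * i)"
    by simp
  then have num: "q_var ^ (6 * j\<^sup>2 + 2 * i\<^sup>2 + 6 * j * i) = fps_const (summand i j) * ?d"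
    unfolding d by (simp only: fps_const_power fps_const_mult)
  have "?n = ?r * ?d"
    unfolding num fps_const_mult[symmetric] fps_const_power[symmetric]
    by (simp add: algebra_simps)
  \<comment> \<open>The quotient is found by multiplying back: division by \<open>?d\<close> is
    exact, and \<open>?d\<close> cancels because the ring has no zero divisors.\<close>
  then have "?n / ?d * ?d = ?r * ?d" by (simp only: denominator_divide_cancel)
  moreover have "?d \<noteq> 0" using c0 unfolding d by auto
  ultimately show ?thesis by (metis mult_right_cancel)
qed

theorem theorem10:
  shows "((\<lambda>(n1, n2).
            q_var ^ (6 * n2\<^sup>2 + 2 * n1\<^sup>2 + 6 * n2 * n1)
              * (1 + x_var * q_var ^ (6 * n2 + 3 * n1 + 1)) * x_var ^ (2 * n2 + n1)
            / (qpoch q_var q_var n1 * qpoch (q_var ^ 3) (q_var ^ 3) n2))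
          has_sum cp0_gf) UNIV"
  unfolding double_sum_term_eq
proof (rule has_sum_fpsI)
  \<comment> \<open>\<open>?J m\<close> indexes the second monomials of degree \<open>m\<close>. At
    \<open>m = 0\<close>, where \<open>m - 1\<close> truncates to 0, the two index sets would
    otherwise coincide.\<close>
  let ?J = "\<lambda>m. if m = 0 then {} else index_pairs (m - 1)"
  let ?f = "\<lambda>(i, j). fps_const (summand i j) * x_var ^ (i + 2 * j)
      + fps_const (summand i j * fps_X ^ (3 * i + 6 * j + 1)) * x_var ^ Suc (i + 2 * j)"
  have nth: "fps_nth (?f (i, j)) m = (if m = i + 2 * j then summand i j else 0)
      + (if m = Suc (i + 2 * j) then summand i j * fps_X ^ (3 * i + 6 * j + 1) else 0)" for i j m
    by (simp add: fps_X_power_nth del: power_Suc)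
  show "finite (index_pairs m \<union> ?J m)" for m by (simp add: finite_index_pairs)
  show "fps_nth (?f p) m = 0" if "p \<in> UNIV - (index_pairs m \<union> ?J m)" for p m
  proof (cases p)
    case (Pair i j)
    with that have "m \<noteq> i + 2 * j" "m \<noteq> Suc (i + 2 * j)" by (auto simp: index_pairs_def split: if_splits)
    then show ?thesis unfolding Pair nth by simp
  qed
  show "fps_nth cp0_gf m = (\<Sum>p\<in>index_pairs m \<union> ?J m. fps_nth (?f p) m)" for m
  proof -
    \<comment> \<open>As \<open>i + 2j\<close> is \<open>m\<close> on the first set and
      \<open>m - 1\<close> on the second, each set picks up one monomial: the first gives
      \<open>S(0, 0)\<close>, the second \<open>x q S(3, 6)\<close>.\<close>
    have "(\<Sum>p\<in>index_pairs m \<union> ?J m. fps_nth (?f p) m) =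
        (\<Sum>p\<in>index_pairs m. fps_nth (?f p) m) + (\<Sum>p\<in>?J m. fps_nth (?f p) m)"
      by (rule sum.union_disjoint) (simp_all add: finite_index_pairs, auto simp: index_pairs_def)
    also have "(\<Sum>p\<in>index_pairs m. fps_nth (?f p) m) = fps_nth (weighted_series 0 0) m"
      unfolding weighted_series_nth
    proof (rule sum_prod_eqI)
      fix i j assume "(i, j) \<in> index_pairs m"
      then have "m = i + 2 * j" by (simp add: index_pairs_def)
      then show "fps_nth (?f (i, j)) m = summand i j * fps_X ^ (0 * i + 0 * j)"
        unfolding nth by simp
    qed
    also have "(\<Sum>p\<in>?J m. fps_nth (?f p) m) = fps_nth (x_var * q_var * weighted_series 3 6) m"
    proof (cases m)
      case (Suc k)
      have "(\<Sum>p\<in>index_pairs k. fps_nth (?f p) m) = fps_X ^ 1 * fps_nth (weighted_series 3 6) k"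
        unfolding fps_X_power_mult_weighted_series_nth
      proof (rule sum_prod_eqI)
        fix i j assume "(i, j) \<in> index_pairs k"
        then have "m = Suc (i + 2 * j)" using Suc by (simp add: index_pairs_def)
        then show "fps_nth (?f (i, j)) m = fps_X ^ 1 * (summand i j * fps_X ^ (3 * i + 6 * j))"
          unfolding nth by simp
      qed
      with Suc show ?thesis by (simp add: mult.assoc)
    qed (simp add: mult.assoc)
    finally show ?thesis by (simp add: cp0_gf_eq_weighted_series)
  qed
qed simp

end
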